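(* Let $k$ be a commutative ring, $A$ a $k$-algebra, $H$ a $k$-bialgebra and $\rho:A\to A\otimes H$ a $k$-linear map. Then $(A,\rho)$ is a right $H$-comodule algebra if and only if $(A,\rho)$ is at the same time a right partial $H$-comodule algebra and a right weak $H$-comodule algebra.
   Context: $\otimes=\otimes_k$; $\delta(h)=h_{(1)}\otimes h_{(2)}$ and $\epsilon$ are the comultiplication and counit of $H$. Write $\rho(a)=a_{[0]}\otimes a_{[1]}$, $\rho^2(a)=(\rho\otimes H)(\rho(a))$, $\rho(1_A)=1_{[0]}\otimes 1_{[1]}$ ($\rho$ is not assumed coassociative). Right $H$-comodule algebra: for all $a,b\in A$, $\rho(ab)=\rho(a)\rho(b)$, $\rho(1_A)=1_A\otimes 1_H$, $\epsilon(a_{[1]})a_{[0]}=a$, and $\rho^2(a)=a_{[0]}\otimes\delta(a_{[1]})$. Right weak $H$-comodule algebra: for all $a,b\in A$, $\rho(ab)=\rho(a)\rho(b)$, $\rho^2(a)=a_{[0]}\otimes\delta(a_{[1]})$, $\epsilon(a_{[1]})a_{[0]}=\epsilon(1_{[1]})1_{[0]}a$, and $\rho(1_A)=\epsilon(1_{[1]})1_{[0]}\otimes 1_H$. Right partial $H$-comodule algebra: for all $a,b\in A$, $\rho(ab)=\rho(a)\rho(b)$, $\rho^2(a)=a_{[0]}1_{[0]}\otimes a_{[1](1)}1_{[1]}\otimes a_{[1](2)}$, and $\epsilon(a_{[1]})a_{[0]}=a$. *)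

theory Defs
  imports "HOL-Algebra.Module" "HOL-Algebra.AbelCoset"
begin

text \<open>
  Carrier-based algebra in the style of HOL-Algebra, so that the zero ring and zero algebras are
  admitted.  All algebras are associative and unital, not necessarily commutative (the locale
  \<^locale>\<open>algebra\<close> of the library is restricted to commutative ones).
\<close>

locale assoc_algebra = module R A + A?: ring A for R (structure) and A (structure) +
  assumes smult_mult_left:
      "\<lbrakk>c \<in> carrier R; x \<in> carrier A; y \<in> carrier A\<rbrakk> \<Longrightarrow>
        (c \<odot>\<^bsub>A\<^esub> x) \<otimes>\<^bsub>A\<^esub> y = c \<odot>\<^bsub>A\<^esub> (x \<otimes>\<^bsub>A\<^esub> y)"
    and smult_mult_right:
      "\<lbrakk>c \<in> carrier R; x \<in> carrier A; y \<in> carrier A\<rbrakk> \<Longrightarrow>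
        x \<otimes>\<^bsub>A\<^esub> (c \<odot>\<^bsub>A\<^esub> y) = c \<odot>\<^bsub>A\<^esub> (x \<otimes>\<^bsub>A\<^esub> y)"

definition linear_map ::
  "('k, 'r) ring_scheme \<Rightarrow> ('k, 'm, 's) module_scheme \<Rightarrow> ('k, 'n, 't) module_scheme
    \<Rightarrow> ('m \<Rightarrow> 'n) \<Rightarrow> bool" where
  "linear_map R M N f \<longleftrightarrow>
     f \<in> carrier M \<rightarrow> carrier N \<and>
     (\<forall>x\<in>carrier M. \<forall>y\<in>carrier M. f (x \<oplus>\<^bsub>M\<^esub> y) = f x \<oplus>\<^bsub>N\<^esub> f y) \<and>
     (\<forall>c\<in>carrier R. \<forall>x\<in>carrier M. f (c \<odot>\<^bsub>M\<^esub> x) = c \<odot>\<^bsub>N\<^esub> f x)"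

definition bilinear_map ::
  "('k, 'r) ring_scheme \<Rightarrow> ('k, 'm, 's) module_scheme \<Rightarrow> ('k, 'n, 't) module_scheme
    \<Rightarrow> ('k, 'p, 'u) module_scheme \<Rightarrow> ('m \<Rightarrow> 'n \<Rightarrow> 'p) \<Rightarrow> bool" where
  "bilinear_map R M N P B \<longleftrightarrow>
     (\<forall>x\<in>carrier M. linear_map R N P (B x)) \<and>
     (\<forall>y\<in>carrier N. linear_map R M P (\<lambda>x. B x y))"


section \<open>Tensor products over a commutative ring\<close>

text \<open>The free module on a set; its ring multiplication and unit are irrelevant.\<close>

definition free_module :: "('k, 'r) ring_scheme \<Rightarrow> 'b set \<Rightarrow> ('k, 'b \<Rightarrow> 'k) module" where
  "free_module R S =
     \<lparr>carrier = {f. range f \<subseteq> carrier R \<and> finite {p. f p \<noteq> \<zero>\<^bsub>R\<^esub>} \<and> {p. f p \<noteq> \<zero>\<^bsub>R\<^esub>} \<subseteq> S},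
      mult = undefined, one = undefined,
      zero = (\<lambda>p. \<zero>\<^bsub>R\<^esub>),
      add = (\<lambda>f g p. f p \<oplus>\<^bsub>R\<^esub> g p),
      smult = (\<lambda>c f p. c \<otimes>\<^bsub>R\<^esub> f p)\<rparr>"

definition free_gen :: "('k, 'r) ring_scheme \<Rightarrow> 'b \<Rightarrow> 'b \<Rightarrow> 'k" where
  "free_gen R p = (\<lambda>q. if q = p then \<one>\<^bsub>R\<^esub> else \<zero>\<^bsub>R\<^esub>)"

abbreviation tensor_free ::
  "('k, 'r) ring_scheme \<Rightarrow> ('k, 'm, 's) module_scheme \<Rightarrow> ('k, 'n, 't) module_scheme
    \<Rightarrow> ('k, 'm \<times> 'n \<Rightarrow> 'k) module" where
  "tensor_free R M N \<equiv> free_module R (carrier M \<times> carrier N)"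

definition tensor_relations ::
  "('k, 'r) ring_scheme \<Rightarrow> ('k, 'm, 's) module_scheme \<Rightarrow> ('k, 'n, 't) module_scheme
    \<Rightarrow> ('m \<times> 'n \<Rightarrow> 'k) set" where
  "tensor_relations R M N =
     (let F = tensor_free R M N; e = (\<lambda>x y. free_gen R (x, y)) in
       {e (x \<oplus>\<^bsub>M\<^esub> x') y \<ominus>\<^bsub>F\<^esub> (e x y \<oplus>\<^bsub>F\<^esub> e x' y) |x x' y.
          x \<in> carrier M \<and> x' \<in> carrier M \<and> y \<in> carrier N} \<union>
       {e x (y \<oplus>\<^bsub>N\<^esub> y') \<ominus>\<^bsub>F\<^esub> (e x y \<oplus>\<^bsub>F\<^esub> e x y') |x y y'.
          x \<in> carrier M \<and> y \<in> carrier N \<and> y' \<in> carrier N} \<union>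
       {e (c \<odot>\<^bsub>M\<^esub> x) y \<ominus>\<^bsub>F\<^esub> c \<odot>\<^bsub>F\<^esub> e x y |c x y.
          c \<in> carrier R \<and> x \<in> carrier M \<and> y \<in> carrier N} \<union>
       {e x (c \<odot>\<^bsub>N\<^esub> y) \<ominus>\<^bsub>F\<^esub> c \<odot>\<^bsub>F\<^esub> e x y |c x y.
          c \<in> carrier R \<and> x \<in> carrier M \<and> y \<in> carrier N})"

definition tensor_kernel ::
  "('k, 'r) ring_scheme \<Rightarrow> ('k, 'm, 's) module_scheme \<Rightarrow> ('k, 'n, 't) module_scheme
    \<Rightarrow> ('m \<times> 'n \<Rightarrow> 'k) set" where
  "tensor_kernel R M N =
     \<Inter>{K. submodule K R (tensor_free R M N) \<and> tensor_relations R M N \<subseteq> K}"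

definition pure_tensor ::
  "('k, 'r) ring_scheme \<Rightarrow> ('k, 'm, 's) module_scheme \<Rightarrow> ('k, 'n, 't) module_scheme
    \<Rightarrow> 'm \<Rightarrow> 'n \<Rightarrow> ('m \<times> 'n \<Rightarrow> 'k) set" where
  "pure_tensor R M N x y = tensor_kernel R M N +>\<^bsub>tensor_free R M N\<^esub> free_gen R (x, y)"

text \<open>
  The value at \<open>t \<in> M \<otimes> N\<close> of the linear map \<open>M \<otimes> N \<rightarrow> P\<close> induced by a bilinear map
  \<open>B : M \<times> N \<rightarrow> P\<close>: if \<open>t = \<Sum>\<^sub>i c\<^sub>i (x\<^sub>i \<otimes> y\<^sub>i)\<close>, then it is \<open>\<Sum>\<^sub>i c\<^sub>i B x\<^sub>i y\<^sub>i\<close>.  For bilinear \<open>B\<close> the result does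
  not depend on the chosen representative of \<open>t\<close> (lemma \<open>tensor_lift_coset\<close> below).  Since Sweedler
  notation abbreviates exactly such induced maps, an expression \<open>B t\<^bsub>(1)\<^esub> t\<^bsub>(2)\<^esub>\<close> with
  \<open>t = t\<^bsub>(1)\<^esub> \<otimes> t\<^bsub>(2)\<^esub>\<close> is rendered as \<open>tensor_lift R P (\<lambda>t1 t2. B t1 t2) t\<close>.
\<close>

definition tensor_eval ::
  "('k, 'r) ring_scheme \<Rightarrow> ('k, 'p, 'u) module_scheme \<Rightarrow> ('m \<Rightarrow> 'n \<Rightarrow> 'p) \<Rightarrow> ('m \<times> 'n \<Rightarrow> 'k) \<Rightarrow> 'p"
  where
  "tensor_eval R P B f =
     (\<Oplus>\<^bsub>P\<^esub>p\<in>{p. f p \<noteq> \<zero>\<^bsub>R\<^esub>}. f p \<odot>\<^bsub>P\<^esub> B (fst p) (snd p))"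

definition tensor_lift ::
  "('k, 'r) ring_scheme \<Rightarrow> ('k, 'p, 'u) module_scheme \<Rightarrow> ('m \<Rightarrow> 'n \<Rightarrow> 'p)
    \<Rightarrow> ('m \<times> 'n \<Rightarrow> 'k) set \<Rightarrow> 'p" where
  "tensor_lift R P B t = tensor_eval R P B (SOME f. f \<in> t)"

text \<open>
  The tensor product of two modules; the multiplication and unit are those of the tensor product
  of algebras.
\<close>

definition tensor_module ::
  "('k, 'r) ring_scheme \<Rightarrow> ('k, 'm, 's) module_scheme \<Rightarrow> ('k, 'n, 't) module_scheme
    \<Rightarrow> ('k, ('m \<times> 'n \<Rightarrow> 'k) set) module" where
  "tensor_module R M N =
     (let F = tensor_free R M N; K = tensor_kernel R M N in
       \<lparr>carrier = a_rcosets\<^bsub>F\<^esub> K, mult = undefined, one = undefined,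
        zero = K,
        add = (\<lambda>s t. s <+>\<^bsub>F\<^esub> t),
        smult = (\<lambda>c t. \<Union>f\<in>t. K +>\<^bsub>F\<^esub> (c \<odot>\<^bsub>F\<^esub> f))\<rparr>)"

definition tensor_algebra ::
  "('k, 'r) ring_scheme \<Rightarrow> ('k, 'm, 's) module_scheme \<Rightarrow> ('k, 'n, 't) module_scheme
    \<Rightarrow> ('k, ('m \<times> 'n \<Rightarrow> 'k) set) module" where
  "tensor_algebra R A B = (tensor_module R A B)
     \<lparr>mult := (\<lambda>s t.
        tensor_lift R (tensor_module R A B) (\<lambda>a b.
          tensor_lift R (tensor_module R A B) (\<lambda>a' b'.
            pure_tensor R A B (a \<otimes>\<^bsub>A\<^esub> a') (b \<otimes>\<^bsub>B\<^esub> b')) t) s),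
      one := pure_tensor R A B \<one>\<^bsub>A\<^esub> \<one>\<^bsub>B\<^esub>\<rparr>"

text \<open>Threefold tensor products are read as \<open>(L \<otimes> M) \<otimes> N\<close>.\<close>

abbreviation tensor_algebra3 ::
  "('k, 'r) ring_scheme \<Rightarrow> ('k, 'l, 'q) module_scheme \<Rightarrow> ('k, 'm, 's) module_scheme
    \<Rightarrow> ('k, 'n, 't) module_scheme \<Rightarrow> ('k, (('l \<times> 'm \<Rightarrow> 'k) set \<times> 'n \<Rightarrow> 'k) set) module" where
  "tensor_algebra3 R L M N \<equiv> tensor_algebra R (tensor_algebra R L M) N"

abbreviation pure_tensor3 ::
  "('k, 'r) ring_scheme \<Rightarrow> ('k, 'l, 'q) module_scheme \<Rightarrow> ('k, 'm, 's) module_scheme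
    \<Rightarrow> ('k, 'n, 't) module_scheme \<Rightarrow> 'l \<Rightarrow> 'm \<Rightarrow> 'n \<Rightarrow> (('l \<times> 'm \<Rightarrow> 'k) set \<times> 'n \<Rightarrow> 'k) set" where
  "pure_tensor3 R L M N x y z \<equiv> pure_tensor R (tensor_algebra R L M) N (pure_tensor R L M x y) z"


section \<open>Bialgebras and comodule algebras\<close>

locale bialgebra = assoc_algebra R H for R (structure) and H (structure) and \<delta> and \<epsilon> +
  assumes comult_linear: "linear_map R H (tensor_algebra R H H) \<delta>"
    and counit_closed: "\<epsilon> \<in> carrier H \<rightarrow> carrier R"
    and counit_add: "\<lbrakk>g \<in> carrier H; h \<in> carrier H\<rbrakk> \<Longrightarrow> \<epsilon> (g \<oplus>\<^bsub>H\<^esub> h) = \<epsilon> g \<oplus> \<epsilon> h"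
    and counit_smult: "\<lbrakk>c \<in> carrier R; h \<in> carrier H\<rbrakk> \<Longrightarrow> \<epsilon> (c \<odot>\<^bsub>H\<^esub> h) = c \<otimes> \<epsilon> h"
    and coassociative: "h \<in> carrier H \<Longrightarrow>
      tensor_lift R (tensor_algebra3 R H H H)
        (\<lambda>h1 h2. pure_tensor R (tensor_algebra R H H) H (\<delta> h1) h2) (\<delta> h) =
      tensor_lift R (tensor_algebra3 R H H H)
        (\<lambda>h1 h2. tensor_lift R (tensor_algebra3 R H H H)
          (\<lambda>h21 h22. pure_tensor3 R H H H h1 h21 h22) (\<delta> h2)) (\<delta> h)"
    and counit_left: "h \<in> carrier H \<Longrightarrow> tensor_lift R H (\<lambda>h1 h2. \<epsilon> h1 \<odot>\<^bsub>H\<^esub> h2) (\<delta> h) = h"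
    and counit_right: "h \<in> carrier H \<Longrightarrow> tensor_lift R H (\<lambda>h1 h2. \<epsilon> h2 \<odot>\<^bsub>H\<^esub> h1) (\<delta> h) = h"
    and comult_mult: "\<lbrakk>g \<in> carrier H; h \<in> carrier H\<rbrakk> \<Longrightarrow>
      \<delta> (g \<otimes>\<^bsub>H\<^esub> h) = \<delta> g \<otimes>\<^bsub>tensor_algebra R H H\<^esub> \<delta> h"
    and comult_one: "\<delta> \<one>\<^bsub>H\<^esub> = \<one>\<^bsub>tensor_algebra R H H\<^esub>"
    and counit_mult: "\<lbrakk>g \<in> carrier H; h \<in> carrier H\<rbrakk> \<Longrightarrow> \<epsilon> (g \<otimes>\<^bsub>H\<^esub> h) = \<epsilon> g \<otimes> \<epsilon> h"
    and counit_one: "\<epsilon> \<one>\<^bsub>H\<^esub> = \<one>"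

text \<open>
  The following operations and predicates are meant for a bialgebra \<open>(H, \<delta>, \<epsilon>)\<close>, an algebra \<open>A\<close>
  and a linear map \<open>\<rho> : A \<rightarrow> A \<otimes> H\<close>, all over \<open>R\<close>.
\<close>

text \<open>\<open>\<rho>\<^sup>2(a) = (\<rho> \<otimes> H)(\<rho>(a))\<close>\<close>

definition coaction_square ::
  "('k, 'r) ring_scheme \<Rightarrow> ('k, 'a, 's) module_scheme \<Rightarrow> ('k, 'h, 't) module_scheme
    \<Rightarrow> ('a \<Rightarrow> ('a \<times> 'h \<Rightarrow> 'k) set) \<Rightarrow> 'a \<Rightarrow> (('a \<times> 'h \<Rightarrow> 'k) set \<times> 'h \<Rightarrow> 'k) set" where
  "coaction_square R A H \<rho> a =
     tensor_lift R (tensor_algebra3 R A H H)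
       (\<lambda>a0 a1. pure_tensor R (tensor_algebra R A H) H (\<rho> a0) a1) (\<rho> a)"

text \<open>\<open>a\<^bsub>[0]\<^esub> \<otimes> \<delta>(a\<^bsub>[1]\<^esub>)\<close>\<close>

definition coaction_comult ::
  "('k, 'r) ring_scheme \<Rightarrow> ('k, 'a, 's) module_scheme \<Rightarrow> ('k, 'h, 't) module_scheme
    \<Rightarrow> ('h \<Rightarrow> ('h \<times> 'h \<Rightarrow> 'k) set) \<Rightarrow> ('a \<Rightarrow> ('a \<times> 'h \<Rightarrow> 'k) set)
    \<Rightarrow> 'a \<Rightarrow> (('a \<times> 'h \<Rightarrow> 'k) set \<times> 'h \<Rightarrow> 'k) set" where
  "coaction_comult R A H \<delta> \<rho> a =
     tensor_lift R (tensor_algebra3 R A H H) (\<lambda>a0 a1.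
       tensor_lift R (tensor_algebra3 R A H H) (\<lambda>a11 a12.
         pure_tensor3 R A H H a0 a11 a12) (\<delta> a1)) (\<rho> a)"

text \<open>\<open>a\<^bsub>[0]\<^esub> 1\<^bsub>[0]\<^esub> \<otimes> a\<^bsub>[1](1)\<^esub> 1\<^bsub>[1]\<^esub> \<otimes> a\<^bsub>[1](2)\<^esub>\<close>\<close>

definition coaction_partial_comult ::
  "('k, 'r) ring_scheme \<Rightarrow> ('k, 'a, 's) module_scheme \<Rightarrow> ('k, 'h, 't) module_scheme
    \<Rightarrow> ('h \<Rightarrow> ('h \<times> 'h \<Rightarrow> 'k) set) \<Rightarrow> ('a \<Rightarrow> ('a \<times> 'h \<Rightarrow> 'k) set)
    \<Rightarrow> 'a \<Rightarrow> (('a \<times> 'h \<Rightarrow> 'k) set \<times> 'h \<Rightarrow> 'k) set" where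
  "coaction_partial_comult R A H \<delta> \<rho> a =
     tensor_lift R (tensor_algebra3 R A H H) (\<lambda>a0 a1.
       tensor_lift R (tensor_algebra3 R A H H) (\<lambda>a11 a12.
         tensor_lift R (tensor_algebra3 R A H H) (\<lambda>e0 e1.
           pure_tensor3 R A H H (a0 \<otimes>\<^bsub>A\<^esub> e0) (a11 \<otimes>\<^bsub>H\<^esub> e1) a12) (\<rho> \<one>\<^bsub>A\<^esub>)) (\<delta> a1)) (\<rho> a)"

text \<open>\<open>\<epsilon>(a\<^bsub>[1]\<^esub>) a\<^bsub>[0]\<^esub>\<close>\<close>

definition coaction_counit ::
  "('k, 'r) ring_scheme \<Rightarrow> ('k, 'a, 's) module_scheme
    \<Rightarrow> ('h \<Rightarrow> 'k) \<Rightarrow> ('a \<Rightarrow> ('a \<times> 'h \<Rightarrow> 'k) set) \<Rightarrow> 'a \<Rightarrow> 'a" where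
  "coaction_counit R A \<epsilon> \<rho> a = tensor_lift R A (\<lambda>a0 a1. \<epsilon> a1 \<odot>\<^bsub>A\<^esub> a0) (\<rho> a)"

definition right_comodule_algebra ::
  "('k, 'r) ring_scheme \<Rightarrow> ('k, 'a, 's) module_scheme \<Rightarrow> ('k, 'h, 't) module_scheme
    \<Rightarrow> ('h \<Rightarrow> ('h \<times> 'h \<Rightarrow> 'k) set) \<Rightarrow> ('h \<Rightarrow> 'k) \<Rightarrow> ('a \<Rightarrow> ('a \<times> 'h \<Rightarrow> 'k) set) \<Rightarrow> bool" where
  "right_comodule_algebra R A H \<delta> \<epsilon> \<rho> \<longleftrightarrow>
     (\<forall>a\<in>carrier A. \<forall>b\<in>carrier A. \<rho> (a \<otimes>\<^bsub>A\<^esub> b) = \<rho> a \<otimes>\<^bsub>tensor_algebra R A H\<^esub> \<rho> b) \<and>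
     \<rho> \<one>\<^bsub>A\<^esub> = pure_tensor R A H \<one>\<^bsub>A\<^esub> \<one>\<^bsub>H\<^esub> \<and>
     (\<forall>a\<in>carrier A. coaction_counit R A \<epsilon> \<rho> a = a) \<and>
     (\<forall>a\<in>carrier A. coaction_square R A H \<rho> a = coaction_comult R A H \<delta> \<rho> a)"

definition right_weak_comodule_algebra ::
  "('k, 'r) ring_scheme \<Rightarrow> ('k, 'a, 's) module_scheme \<Rightarrow> ('k, 'h, 't) module_scheme
    \<Rightarrow> ('h \<Rightarrow> ('h \<times> 'h \<Rightarrow> 'k) set) \<Rightarrow> ('h \<Rightarrow> 'k) \<Rightarrow> ('a \<Rightarrow> ('a \<times> 'h \<Rightarrow> 'k) set) \<Rightarrow> bool" where
  "right_weak_comodule_algebra R A H \<delta> \<epsilon> \<rho> \<longleftrightarrow>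
     (\<forall>a\<in>carrier A. \<forall>b\<in>carrier A. \<rho> (a \<otimes>\<^bsub>A\<^esub> b) = \<rho> a \<otimes>\<^bsub>tensor_algebra R A H\<^esub> \<rho> b) \<and>
     (\<forall>a\<in>carrier A. coaction_square R A H \<rho> a = coaction_comult R A H \<delta> \<rho> a) \<and>
     (\<forall>a\<in>carrier A. coaction_counit R A \<epsilon> \<rho> a = coaction_counit R A \<epsilon> \<rho> \<one>\<^bsub>A\<^esub> \<otimes>\<^bsub>A\<^esub> a) \<and>
     \<rho> \<one>\<^bsub>A\<^esub> = pure_tensor R A H (coaction_counit R A \<epsilon> \<rho> \<one>\<^bsub>A\<^esub>) \<one>\<^bsub>H\<^esub>"

definition right_partial_comodule_algebra ::
  "('k, 'r) ring_scheme \<Rightarrow> ('k, 'a, 's) module_scheme \<Rightarrow> ('k, 'h, 't) module_scheme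
    \<Rightarrow> ('h \<Rightarrow> ('h \<times> 'h \<Rightarrow> 'k) set) \<Rightarrow> ('h \<Rightarrow> 'k) \<Rightarrow> ('a \<Rightarrow> ('a \<times> 'h \<Rightarrow> 'k) set) \<Rightarrow> bool" where
  "right_partial_comodule_algebra R A H \<delta> \<epsilon> \<rho> \<longleftrightarrow>
     (\<forall>a\<in>carrier A. \<forall>b\<in>carrier A. \<rho> (a \<otimes>\<^bsub>A\<^esub> b) = \<rho> a \<otimes>\<^bsub>tensor_algebra R A H\<^esub> \<rho> b) \<and>
     (\<forall>a\<in>carrier A. coaction_square R A H \<rho> a = coaction_partial_comult R A H \<delta> \<rho> a) \<and>
     (\<forall>a\<in>carrier A. coaction_counit R A \<epsilon> \<rho> a = a)"


section \<open>Well-definedness and universal property of the tensor product\<close>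

lemma free_module_simps:
  "f \<in> carrier (free_module R S) \<longleftrightarrow>
     range f \<subseteq> carrier R \<and> finite {p. f p \<noteq> \<zero>\<^bsub>R\<^esub>} \<and> {p. f p \<noteq> \<zero>\<^bsub>R\<^esub>} \<subseteq> S"
  "\<zero>\<^bsub>free_module R S\<^esub> = (\<lambda>p. \<zero>\<^bsub>R\<^esub>)"
  "f \<oplus>\<^bsub>free_module R S\<^esub> g = (\<lambda>p. f p \<oplus>\<^bsub>R\<^esub> g p)"
  "c \<odot>\<^bsub>free_module R S\<^esub> f = (\<lambda>p. c \<otimes>\<^bsub>R\<^esub> f p)"
  by (auto simp: free_module_def)

lemma module_free_module:
  assumes "cring R"
  shows "module R (free_module R S)"
proof -
  interpret R: cring R by fact
  have closed: "f p \<in> carrier R" if "f \<in> carrier (free_module R S)" for f p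
    using that by (auto simp: free_module_simps)
  have sm: "c \<odot>\<^bsub>free_module R S\<^esub> f \<in> carrier (free_module R S)"
    if c: "c \<in> carrier R" and f: "f \<in> carrier (free_module R S)" for c f
  proof -
    have sub: "{p. c \<otimes>\<^bsub>R\<^esub> f p \<noteq> \<zero>\<^bsub>R\<^esub>} \<subseteq> {p. f p \<noteq> \<zero>\<^bsub>R\<^esub>}" using c by auto
    show ?thesis
      using f c sub finite_subset[OF sub] closed[OF f] unfolding free_module_simps by auto
  qed
  have ad: "f \<oplus>\<^bsub>free_module R S\<^esub> g \<in> carrier (free_module R S)"
    if f: "f \<in> carrier (free_module R S)" and g: "g \<in> carrier (free_module R S)" for f g
  proof -
    have sub: "{p. f p \<oplus>\<^bsub>R\<^esub> g p \<noteq> \<zero>\<^bsub>R\<^esub>} \<subseteq> {p. f p \<noteq> \<zero>\<^bsub>R\<^esub>} \<union> {p. g p \<noteq> \<zero>\<^bsub>R\<^esub>}" by auto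
    have fin: "finite ({p. f p \<noteq> \<zero>\<^bsub>R\<^esub>} \<union> {p. g p \<noteq> \<zero>\<^bsub>R\<^esub>})"
      using f g by (auto simp: free_module_simps)
    show ?thesis
      using f g sub finite_subset[OF sub fin] closed[OF f] closed[OF g]
      unfolding free_module_simps by blast
  qed
  have neg: "\<exists>g\<in>carrier (free_module R S). g \<oplus>\<^bsub>free_module R S\<^esub> f = \<zero>\<^bsub>free_module R S\<^esub>"
    if f: "f \<in> carrier (free_module R S)" for f
  proof
    show "(\<ominus>\<^bsub>R\<^esub> \<one>\<^bsub>R\<^esub>) \<odot>\<^bsub>free_module R S\<^esub> f \<in> carrier (free_module R S)"
      by (rule sm) (use f in auto)
    show "((\<ominus>\<^bsub>R\<^esub> \<one>\<^bsub>R\<^esub>) \<odot>\<^bsub>free_module R S\<^esub> f) \<oplus>\<^bsub>free_module R S\<^esub> f = \<zero>\<^bsub>free_module R S\<^esub>"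
      using closed[OF f] by (simp add: free_module_simps(2-) R.l_minus R.l_neg)
  qed
  have z: "\<zero>\<^bsub>free_module R S\<^esub> \<in> carrier (free_module R S)"
    by (auto simp: free_module_simps)
  have ag: "abelian_group (free_module R S)"
  proof (rule abelian_groupI)
    fix x y w
    assume x: "x \<in> carrier (free_module R S)"
    then show "\<zero>\<^bsub>free_module R S\<^esub> \<oplus>\<^bsub>free_module R S\<^esub> x = x"
      using closed by (simp add: free_module_simps(2-))
    assume y: "y \<in> carrier (free_module R S)"
    show "x \<oplus>\<^bsub>free_module R S\<^esub> y = y \<oplus>\<^bsub>free_module R S\<^esub> x"
      using closed[OF x] closed[OF y] by (simp add: free_module_simps(2-) R.a_comm)
    assume w: "w \<in> carrier (free_module R S)"
    show "x \<oplus>\<^bsub>free_module R S\<^esub> y \<oplus>\<^bsub>free_module R S\<^esub> w = x \<oplus>\<^bsub>free_module R S\<^esub> (y \<oplus>\<^bsub>free_module R S\<^esub> w)"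
      using closed[OF x] closed[OF y] closed[OF w] by (simp add: free_module_simps(2-) R.a_assoc)
  qed (use ad z neg in auto)
  show ?thesis
  proof (rule moduleI)
    fix c d x y
    assume c: "c \<in> carrier R" and x: "x \<in> carrier (free_module R S)"
    show "c \<odot>\<^bsub>free_module R S\<^esub> x \<in> carrier (free_module R S)" by (rule sm[OF c x])
    assume d: "d \<in> carrier R"
    show "(c \<oplus>\<^bsub>R\<^esub> d) \<odot>\<^bsub>free_module R S\<^esub> x =
        c \<odot>\<^bsub>free_module R S\<^esub> x \<oplus>\<^bsub>free_module R S\<^esub> d \<odot>\<^bsub>free_module R S\<^esub> x"
      and "(c \<otimes>\<^bsub>R\<^esub> d) \<odot>\<^bsub>free_module R S\<^esub> x =
        c \<odot>\<^bsub>free_module R S\<^esub> (d \<odot>\<^bsub>free_module R S\<^esub> x)"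
      using c d closed[OF x] by (simp_all add: free_module_simps(2-) R.l_distr R.m_assoc)
  next
    fix c x y
    assume c: "c \<in> carrier R" and x: "x \<in> carrier (free_module R S)"
      and y: "y \<in> carrier (free_module R S)"
    show "c \<odot>\<^bsub>free_module R S\<^esub> (x \<oplus>\<^bsub>free_module R S\<^esub> y) =
        c \<odot>\<^bsub>free_module R S\<^esub> x \<oplus>\<^bsub>free_module R S\<^esub> c \<odot>\<^bsub>free_module R S\<^esub> y"
      using c closed[OF x] closed[OF y] by (simp add: free_module_simps(2-) R.r_distr)
  next
    fix x assume x: "x \<in> carrier (free_module R S)"
    show "\<one>\<^bsub>R\<^esub> \<odot>\<^bsub>free_module R S\<^esub> x = x" using closed[OF x] by (simp add: free_module_simps(2-))
  qed (fact ag assms)+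
qed

lemma free_gen_carrier:
  assumes "cring R" "p \<in> S"
  shows "free_gen R p \<in> carrier (free_module R S)"
proof -
  interpret R: cring R by fact
  have "{q. free_gen R p q \<noteq> \<zero>\<^bsub>R\<^esub>} \<subseteq> {p}" by (auto simp: free_gen_def)
  from this finite_subset[OF this] show ?thesis
    using assms by (auto simp: free_module_simps free_gen_def)
qed

lemma linear_mapD:
  assumes "linear_map R M N f"
  shows "x \<in> carrier M \<Longrightarrow> f x \<in> carrier N"
    and "x \<in> carrier M \<Longrightarrow> y \<in> carrier M \<Longrightarrow> f (x \<oplus>\<^bsub>M\<^esub> y) = f x \<oplus>\<^bsub>N\<^esub> f y"
    and "c \<in> carrier R \<Longrightarrow> x \<in> carrier M \<Longrightarrow> f (c \<odot>\<^bsub>M\<^esub> x) = c \<odot>\<^bsub>N\<^esub> f x"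
  using assms by (auto simp: linear_map_def)

lemma bilinear_mapD:
  assumes "bilinear_map R M N P B"
  shows "x \<in> carrier M \<Longrightarrow> y \<in> carrier N \<Longrightarrow> B x y \<in> carrier P"
    and "x \<in> carrier M \<Longrightarrow> x' \<in> carrier M \<Longrightarrow> y \<in> carrier N \<Longrightarrow>
      B (x \<oplus>\<^bsub>M\<^esub> x') y = B x y \<oplus>\<^bsub>P\<^esub> B x' y"
    and "x \<in> carrier M \<Longrightarrow> y \<in> carrier N \<Longrightarrow> y' \<in> carrier N \<Longrightarrow>
      B x (y \<oplus>\<^bsub>N\<^esub> y') = B x y \<oplus>\<^bsub>P\<^esub> B x y'"
    and "c \<in> carrier R \<Longrightarrow> x \<in> carrier M \<Longrightarrow> y \<in> carrier N \<Longrightarrow> B (c \<odot>\<^bsub>M\<^esub> x) y = c \<odot>\<^bsub>P\<^esub> B x y"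
    and "c \<in> carrier R \<Longrightarrow> x \<in> carrier M \<Longrightarrow> y \<in> carrier N \<Longrightarrow> B x (c \<odot>\<^bsub>N\<^esub> y) = c \<odot>\<^bsub>P\<^esub> B x y"
  using assms by (auto simp: bilinear_map_def linear_map_def)

lemma bilinear_map_funcset:
  "bilinear_map R M N P B \<Longrightarrow> B \<in> carrier M \<rightarrow> carrier N \<rightarrow> carrier P"
  by (auto simp: bilinear_map_def linear_map_def)

lemma linear_map_zero_minus:
  assumes "module R M" "module R N" "linear_map R M N f"
  shows "f \<zero>\<^bsub>M\<^esub> = \<zero>\<^bsub>N\<^esub>"
    and "x \<in> carrier M \<Longrightarrow> f (\<ominus>\<^bsub>M\<^esub> x) = \<ominus>\<^bsub>N\<^esub> f x"
    and "x \<in> carrier M \<Longrightarrow> y \<in> carrier M \<Longrightarrow> f (x \<ominus>\<^bsub>M\<^esub> y) = f x \<ominus>\<^bsub>N\<^esub> f y"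
proof -
  interpret M: module R M by fact
  interpret N: module R N by fact
  note f = linear_mapD[OF assms(3)]
  show z: "f \<zero>\<^bsub>M\<^esub> = \<zero>\<^bsub>N\<^esub>"
    using f(3)[of "\<zero>\<^bsub>R\<^esub>" "\<zero>\<^bsub>M\<^esub>"] f(1)[of "\<zero>\<^bsub>M\<^esub>"] by simp
  show neg: "f (\<ominus>\<^bsub>M\<^esub> x) = \<ominus>\<^bsub>N\<^esub> f x" if "x \<in> carrier M" for x
    using f(2)[of "\<ominus>\<^bsub>M\<^esub> x" x] f(1) that z by (metis M.M.a_inv_closed M.M.l_neg N.M.minus_equality)
  show "f (x \<ominus>\<^bsub>M\<^esub> y) = f x \<ominus>\<^bsub>N\<^esub> f y" if "x \<in> carrier M" "y \<in> carrier M" for x y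
    using f that neg by (simp add: a_minus_def)
qed

lemma tensor_eval_superset:
  assumes "module R P" and "B \<in> carrier M \<rightarrow> carrier N \<rightarrow> carrier P"
    and "f \<in> carrier (tensor_free R M N)" "finite T" "{p. f p \<noteq> \<zero>\<^bsub>R\<^esub>} \<subseteq> T"
    and "T \<subseteq> carrier M \<times> carrier N"
  shows "tensor_eval R P B f = (\<Oplus>\<^bsub>P\<^esub>p\<in>T. f p \<odot>\<^bsub>P\<^esub> B (fst p) (snd p))"
proof -
  interpret P: module R P by fact
  have f: "f p \<in> carrier R" for p using assms(3) by (auto simp: free_module_simps)
  have b: "B (fst p) (snd p) \<in> carrier P" if "p \<in> carrier M \<times> carrier N" for p
    using assms(2) that by (auto simp: Pi_iff)
  show ?thesis unfolding tensor_eval_def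
  proof (rule P.M.add.finprod_mono_neutral_cong_left[OF assms(4,5)])
    show "f i \<odot>\<^bsub>P\<^esub> B (fst i) (snd i) = \<zero>\<^bsub>P\<^esub>" if "i \<in> T - {p. f p \<noteq> \<zero>\<^bsub>R\<^esub>}" for i
      using b assms(6) that by fastforce
    show "(\<lambda>p. f p \<odot>\<^bsub>P\<^esub> B (fst p) (snd p)) \<in> T \<rightarrow> carrier P"
      using b assms(6) f by fastforce
  qed auto
qed

lemma linear_map_tensor_eval:
  assumes "module R P" "B \<in> carrier M \<rightarrow> carrier N \<rightarrow> carrier P"
  shows "linear_map R (tensor_free R M N) P (tensor_eval R P B)"
proof -
  interpret P: module R P by fact
  interpret F: module R "tensor_free R M N"
    by (rule module_free_module) (rule P.R.is_cring)
  let ?F = "tensor_free R M N"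
  let ?b = "\<lambda>p. B (fst p) (snd p)"
  note sup = tensor_eval_superset[OF assms]
  have b: "?b p \<in> carrier P" if "p \<in> carrier M \<times> carrier N" for p
    using assms(2) that by (auto simp: Pi_iff)
  have cf: "f p \<in> carrier R" if "f \<in> carrier ?F" for f p
    using that by (auto simp: free_module_simps)
  have ft: "(\<lambda>p. f p \<odot>\<^bsub>P\<^esub> ?b p) \<in> T \<rightarrow> carrier P"
    if "f \<in> carrier ?F" "T \<subseteq> carrier M \<times> carrier N" for f T
    using b that(2) cf[OF that(1)] by fastforce
  show ?thesis unfolding linear_map_def
  proof (intro conjI ballI funcsetI)
    fix f assume f: "f \<in> carrier ?F"
    let ?S = "{p. f p \<noteq> \<zero>\<^bsub>R\<^esub>}"
    have S: "?S \<subseteq> carrier M \<times> carrier N" "finite ?S" using f by (auto simp: free_module_simps)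
    show "tensor_eval R P B f \<in> carrier P"
      unfolding tensor_eval_def using ft[OF f S(1)] by (rule P.M.finsum_closed)
    {
      fix c assume c: "c \<in> carrier R"
      have "tensor_eval R P B (c \<odot>\<^bsub>?F\<^esub> f) = (\<Oplus>\<^bsub>P\<^esub>p\<in>?S. (c \<odot>\<^bsub>?F\<^esub> f) p \<odot>\<^bsub>P\<^esub> ?b p)"
        by (rule sup) (use f c S F.smult_closed[OF c f] in \<open>auto simp: free_module_simps(2-4)\<close>)
      also have "\<dots> = (\<Oplus>\<^bsub>P\<^esub>p\<in>?S. c \<odot>\<^bsub>P\<^esub> (f p \<odot>\<^bsub>P\<^esub> ?b p))"
        by (rule P.M.finsum_cong')
          (use b c cf[OF f] S in \<open>fastforce simp: free_module_simps(2-) P.smult_assoc1\<close>)+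
      also have "\<dots> = c \<odot>\<^bsub>P\<^esub> tensor_eval R P B f"
        unfolding tensor_eval_def using P.finsum_smult_ldistr[OF S(2) c ft[OF f S(1)]] by simp
      finally show "tensor_eval R P B (c \<odot>\<^bsub>?F\<^esub> f) = c \<odot>\<^bsub>P\<^esub> tensor_eval R P B f" .
    }
    fix g assume g: "g \<in> carrier ?F"
    let ?T = "?S \<union> {p. g p \<noteq> \<zero>\<^bsub>R\<^esub>}"
    have T: "?T \<subseteq> carrier M \<times> carrier N" "finite ?T"
      using f g by (auto simp: free_module_simps)
    have "tensor_eval R P B (f \<oplus>\<^bsub>?F\<^esub> g) = (\<Oplus>\<^bsub>P\<^esub>p\<in>?T. (f \<oplus>\<^bsub>?F\<^esub> g) p \<odot>\<^bsub>P\<^esub> ?b p)"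
      by (rule sup) (use f g T F.M.a_closed[OF f g] in \<open>auto simp: free_module_simps(2-4)\<close>)
    also have "\<dots> = (\<Oplus>\<^bsub>P\<^esub>p\<in>?T. f p \<odot>\<^bsub>P\<^esub> ?b p \<oplus>\<^bsub>P\<^esub> g p \<odot>\<^bsub>P\<^esub> ?b p)"
    proof (rule P.M.finsum_cong')
      fix p assume "p \<in> ?T"
      then have "?b p \<in> carrier P" using T(1) b by blast
      then show "(f \<oplus>\<^bsub>?F\<^esub> g) p \<odot>\<^bsub>P\<^esub> ?b p = f p \<odot>\<^bsub>P\<^esub> ?b p \<oplus>\<^bsub>P\<^esub> g p \<odot>\<^bsub>P\<^esub> ?b p"
        using cf[OF f] cf[OF g] by (simp add: free_module_simps(2-) P.smult_l_distr)
    qed (use ft[OF f T(1)] ft[OF g T(1)] in auto)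
    also have "\<dots> = (\<Oplus>\<^bsub>P\<^esub>p\<in>?T. f p \<odot>\<^bsub>P\<^esub> ?b p) \<oplus>\<^bsub>P\<^esub> (\<Oplus>\<^bsub>P\<^esub>p\<in>?T. g p \<odot>\<^bsub>P\<^esub> ?b p)"
      by (rule P.M.finsum_addf[OF ft[OF f T(1)] ft[OF g T(1)]])
    also have "(\<Oplus>\<^bsub>P\<^esub>p\<in>?T. f p \<odot>\<^bsub>P\<^esub> ?b p) = tensor_eval R P B f"
      by (rule sup[symmetric]) (use f T in auto)
    also have "(\<Oplus>\<^bsub>P\<^esub>p\<in>?T. g p \<odot>\<^bsub>P\<^esub> ?b p) = tensor_eval R P B g"
      by (rule sup[symmetric]) (use g T in auto)
    finally show "tensor_eval R P B (f \<oplus>\<^bsub>?F\<^esub> g) = tensor_eval R P B f \<oplus>\<^bsub>P\<^esub> tensor_eval R P B g" .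
  qed
qed

lemma tensor_eval_gen:
  fixes R :: "('k, 'r) ring_scheme" and M :: "('k, 'm, 's) module_scheme" and N :: "('k, 'n, 't) module_scheme"
  assumes "module R P" "B \<in> carrier M \<rightarrow> carrier N \<rightarrow> carrier P"
    and "x \<in> carrier M" "y \<in> carrier N"
  shows "tensor_eval R P B (free_gen R (x, y)) = B x y"
proof -
  interpret P: module R P by fact
  have "tensor_eval R P B (free_gen R (x, y)) =
      (\<Oplus>\<^bsub>P\<^esub>p\<in>{(x, y)}. free_gen R (x, y) p \<odot>\<^bsub>P\<^esub> B (fst p) (snd p))"
    by (rule tensor_eval_superset[where M = M and N = N, OF assms(1,2)])
      (use assms(3,4) free_gen_carrier[OF P.R.is_cring, of "(x, y)"] in \<open>auto simp: free_gen_def split: if_splits\<close>)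
  also have "\<dots> = B x y" using assms(2-4) by (simp add: free_gen_def Pi_iff)
  finally show ?thesis .
qed

lemma submodule_Inter:
  assumes "module R M" "\<And>K. K \<in> \<K> \<Longrightarrow> submodule K R M" "\<K> \<noteq> {}"
  shows "submodule (\<Inter>\<K>) R M"
proof -
  interpret M: module R M by fact
  show ?thesis
  proof (rule M.submoduleI)
    show "\<Inter>\<K> \<subseteq> carrier M"
      using assms(3) M.submoduleE(1)[OF assms(2)] by blast
    show "\<zero>\<^bsub>M\<^esub> \<in> \<Inter>\<K>"
    proof
      show "\<zero>\<^bsub>M\<^esub> \<in> K" if "K \<in> \<K>" for K
        using subgroup.one_closed[OF submodule.axioms(1)[OF assms(2)[OF that]]] by simp
    qed
    show "\<ominus>\<^bsub>M\<^esub> x \<in> \<Inter>\<K>" if "x \<in> \<Inter>\<K>" for x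
      using that M.submoduleE(3)[OF assms(2)] by blast
    show "x \<oplus>\<^bsub>M\<^esub> y \<in> \<Inter>\<K>" if "x \<in> \<Inter>\<K>" "y \<in> \<Inter>\<K>" for x y
      using that M.submoduleE(5)[OF assms(2)] by blast
    show "c \<odot>\<^bsub>M\<^esub> x \<in> \<Inter>\<K>" if "c \<in> carrier R" "x \<in> \<Inter>\<K>" for c x
      using that M.submoduleE(4)[OF assms(2)] by blast
  qed
qed

lemma tensor_relations_subset:
  assumes "module R M" "module R N"
  shows "tensor_relations R M N \<subseteq> carrier (tensor_free R M N)"
proof -
  interpret M: module R M by fact
  interpret N: module R N by fact
  interpret F: module R "tensor_free R M N"
    by (rule module_free_module) (rule M.R.is_cring)
  have "free_gen R (x, y) \<in> carrier (tensor_free R M N)" if "x \<in> carrier M" "y \<in> carrier N" for x y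
    by (rule free_gen_carrier[OF M.R.is_cring]) (use that in auto)
  then show ?thesis unfolding tensor_relations_def by (auto simp: Let_def)
qed

lemma submodule_tensor_kernel:
  assumes "module R M" "module R N"
  shows "submodule (tensor_kernel R M N) R (tensor_free R M N)"
proof -
  interpret M: module R M by fact
  interpret F: module R "tensor_free R M N"
    by (rule module_free_module) (rule M.R.is_cring)
  show ?thesis unfolding tensor_kernel_def
    by (rule submodule_Inter)
      (use F.carrier_is_submodule tensor_relations_subset[OF assms] F.module_axioms in auto)
qed

lemma tensor_relations_kernel: "tensor_relations R M N \<subseteq> tensor_kernel R M N"
  by (auto simp: tensor_kernel_def)

lemma tensor_eval_kernel:
  assumes "module R M" "module R N" "module R P" "bilinear_map R M N P B"
    and "f \<in> tensor_kernel R M N"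
  shows "tensor_eval R P B f = \<zero>\<^bsub>P\<^esub>"
proof -
  interpret M: module R M by fact
  interpret N: module R N by fact
  interpret P: module R P by fact
  let ?F = "tensor_free R M N"
  interpret F: module R ?F
    by (rule module_free_module) (rule M.R.is_cring)
  note B = bilinear_mapD[OF assms(4)]
  have lin: "linear_map R ?F P (tensor_eval R P B)"
    by (rule linear_map_tensor_eval[OF assms(3) bilinear_map_funcset[OF assms(4)]])
  note L = linear_mapD[OF lin] linear_map_zero_minus[OF F.module_axioms assms(3) lin]
  have gen: "tensor_eval R P B (free_gen R (x, y)) = B x y"
    "free_gen R (x, y) \<in> carrier ?F" if "x \<in> carrier M" "y \<in> carrier N" for x y
  proof -
    show "tensor_eval R P B (free_gen R (x, y)) = B x y"
      by (rule tensor_eval_gen[OF assms(3) bilinear_map_funcset[OF assms(4)] that])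
    show "free_gen R (x, y) \<in> carrier ?F"
      by (rule free_gen_carrier[OF M.R.is_cring]) (use that in auto)
  qed
  let ?K = "{f \<in> carrier ?F. tensor_eval R P B f = \<zero>\<^bsub>P\<^esub>}"
  have "submodule ?K R ?F"
    by (rule F.submoduleI) (auto simp: L)
  moreover have "tensor_relations R M N \<subseteq> ?K"
  proof
    fix r assume r: "r \<in> tensor_relations R M N"
    from r have "tensor_eval R P B r = \<zero>\<^bsub>P\<^esub>"
      unfolding tensor_relations_def Let_def
      by (elim UnE CollectE exE conjE) (simp_all add: L gen B P.M.r_neg a_minus_def[of P])
    then show "r \<in> ?K" using r tensor_relations_subset[OF assms(1,2)] by blast
  qed
  ultimately show ?thesis using assms(5) by (auto simp: tensor_kernel_def)
qed

lemma tensor_lift_coset: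
  assumes "module R M" "module R N" "module R P" "bilinear_map R M N P B"
    and "f \<in> carrier (tensor_free R M N)"
  shows "tensor_lift R P B (tensor_kernel R M N +>\<^bsub>tensor_free R M N\<^esub> f) = tensor_eval R P B f"
proof -
  interpret M: module R M by fact
  interpret P: module R P by fact
  let ?F = "tensor_free R M N"
  interpret F: module R ?F
    by (rule module_free_module) (rule M.R.is_cring)
  let ?X = "tensor_kernel R M N +>\<^bsub>?F\<^esub> f"
  note K = F.submoduleE[OF submodule_tensor_kernel[OF assms(1,2)]]
  have X: "?X = {k \<oplus>\<^bsub>?F\<^esub> f |k. k \<in> tensor_kernel R M N}"
    by (auto simp: a_r_coset_def')
  have "?X \<noteq> {}" using K(2) unfolding X by auto
  then have "(SOME g. g \<in> ?X) \<in> ?X" by (simp add: some_in_eq)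
  then obtain k where k: "k \<in> tensor_kernel R M N" "(SOME g. g \<in> ?X) = k \<oplus>\<^bsub>?F\<^esub> f"
    unfolding X by auto
  have lin: "linear_map R ?F P (tensor_eval R P B)"
    by (rule linear_map_tensor_eval[OF assms(3) bilinear_map_funcset[OF assms(4)]])
  have "tensor_eval R P B (k \<oplus>\<^bsub>?F\<^esub> f) = \<zero>\<^bsub>P\<^esub> \<oplus>\<^bsub>P\<^esub> tensor_eval R P B f"
    using linear_mapD(2)[OF lin _ assms(5), of k] k(1) K(1) tensor_eval_kernel[OF assms(1-4) k(1)] by auto
  then show ?thesis
    using linear_mapD(1)[OF lin assms(5)] k(2) by (simp add: tensor_lift_def)
qed

lemma tensor_lift_pure:
  assumes "module R M" "module R N" "module R P" "bilinear_map R M N P B"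
    and "x \<in> carrier M" "y \<in> carrier N"
  shows "tensor_lift R P B (pure_tensor R M N x y) = B x y"
proof -
  have "cring R" using assms(1) by (simp add: module_def)
  then have "free_gen R (x, y) \<in> carrier (tensor_free R M N)"
    by (rule free_gen_carrier) (use assms(5,6) in auto)
  then show ?thesis unfolding pure_tensor_def
    using tensor_lift_coset[OF assms(1-4)]
      tensor_eval_gen[OF assms(3) bilinear_map_funcset[OF assms(4)] assms(5,6)] by simp
qed

lemma abelian_subgroup_tensor_kernel:
  assumes "module R M" "module R N"
  shows "abelian_subgroup (tensor_kernel R M N) (tensor_free R M N)"
proof -
  interpret M: module R M by fact
  interpret F: module R "tensor_free R M N"
    by (rule module_free_module) (rule M.R.is_cring)
  show ?thesis
    by (rule abelian_subgroupI3[OF additive_subgroup.intro])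
      (use submodule.axioms(1)[OF submodule_tensor_kernel[OF assms]] F.M.abelian_group_axioms in auto)
qed

lemma tensor_coset_eqI:
  assumes "module R M" "module R N"
    and "f \<in> carrier (tensor_free R M N)" "g \<in> carrier (tensor_free R M N)"
    and "f \<ominus>\<^bsub>tensor_free R M N\<^esub> g \<in> tensor_kernel R M N"
  shows "tensor_kernel R M N +>\<^bsub>tensor_free R M N\<^esub> f =
    tensor_kernel R M N +>\<^bsub>tensor_free R M N\<^esub> g"
proof -
  interpret M: module R M by fact
  interpret F: module R "tensor_free R M N"
    by (rule module_free_module) (rule M.R.is_cring)
  interpret K: abelian_subgroup "tensor_kernel R M N" "tensor_free R M N"
    by (rule abelian_subgroup_tensor_kernel[OF assms(1,2)])
  have "f \<in> tensor_kernel R M N +>\<^bsub>tensor_free R M N\<^esub> g"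
    using K.a_rcos_module[OF assms(4,3)] assms(5) by (simp add: a_minus_def)
  then show ?thesis
    using F.M.a_repr_independence[OF _ assms(4) K.a_subgroup] by metis
qed

lemma tensor_algebra_sel:
  "carrier (tensor_algebra R M N) = a_rcosets\<^bsub>tensor_free R M N\<^esub> tensor_kernel R M N"
  "\<zero>\<^bsub>tensor_algebra R M N\<^esub> = tensor_kernel R M N"
  "s \<oplus>\<^bsub>tensor_algebra R M N\<^esub> t = s <+>\<^bsub>tensor_free R M N\<^esub> t"
  "c \<odot>\<^bsub>tensor_algebra R M N\<^esub> t =
     (\<Union>f\<in>t. tensor_kernel R M N +>\<^bsub>tensor_free R M N\<^esub> (c \<odot>\<^bsub>tensor_free R M N\<^esub> f))"
  "\<one>\<^bsub>tensor_algebra R M N\<^esub> = pure_tensor R M N \<one>\<^bsub>M\<^esub> \<one>\<^bsub>N\<^esub>"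
  "s \<otimes>\<^bsub>tensor_algebra R M N\<^esub> t =
        tensor_lift R (tensor_module R M N) (\<lambda>a b.
          tensor_lift R (tensor_module R M N) (\<lambda>a' b'.
            pure_tensor R M N (a \<otimes>\<^bsub>M\<^esub> a') (b \<otimes>\<^bsub>N\<^esub> b')) t) s"
  by (simp_all add: tensor_algebra_def tensor_module_def Let_def)

lemma tensor_coset:
  assumes "module R M" "module R N"
  defines "F \<equiv> tensor_free R M N" and "K \<equiv> tensor_kernel R M N"
  shows "t \<in> a_rcosets\<^bsub>F\<^esub> K \<longleftrightarrow> (\<exists>f\<in>carrier F. t = K +>\<^bsub>F\<^esub> f)"
    and "K +>\<^bsub>F\<^esub> \<zero>\<^bsub>F\<^esub> = K"
    and "f \<in> carrier F \<Longrightarrow> g \<in> carrier F \<Longrightarrow> (K +>\<^bsub>F\<^esub> f) <+>\<^bsub>F\<^esub> (K +>\<^bsub>F\<^esub> g) = K +>\<^bsub>F\<^esub> (f \<oplus>\<^bsub>F\<^esub> g)"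
    and "f \<in> carrier F \<Longrightarrow> c \<in> carrier R \<Longrightarrow>
      (\<Union>g\<in>(K +>\<^bsub>F\<^esub> f). K +>\<^bsub>F\<^esub> (c \<odot>\<^bsub>F\<^esub> g)) = K +>\<^bsub>F\<^esub> (c \<odot>\<^bsub>F\<^esub> f)"
proof -
  interpret M: module R M by fact
  interpret F: module R F unfolding F_def
    by (rule module_free_module) (rule M.R.is_cring)
  interpret K: abelian_subgroup K F unfolding F_def K_def
    by (rule abelian_subgroup_tensor_kernel[OF assms(1,2)])
  have sub: "submodule K R F" unfolding F_def K_def by (rule submodule_tensor_kernel[OF assms(1,2)])
  note E = F.submoduleE[OF sub]
  show "t \<in> a_rcosets\<^bsub>F\<^esub> K \<longleftrightarrow> (\<exists>f\<in>carrier F. t = K +>\<^bsub>F\<^esub> f)"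
    by (auto simp: A_RCOSETS_def')
  show "K +>\<^bsub>F\<^esub> \<zero>\<^bsub>F\<^esub> = K" by (rule F.M.a_coset_add_zero[OF E(1)])
  show "f \<in> carrier F \<Longrightarrow> g \<in> carrier F \<Longrightarrow> (K +>\<^bsub>F\<^esub> f) <+>\<^bsub>F\<^esub> (K +>\<^bsub>F\<^esub> g) = K +>\<^bsub>F\<^esub> (f \<oplus>\<^bsub>F\<^esub> g)"
    by (rule K.a_rcos_sum)
  show "(\<Union>g\<in>(K +>\<^bsub>F\<^esub> f). K +>\<^bsub>F\<^esub> (c \<odot>\<^bsub>F\<^esub> g)) = K +>\<^bsub>F\<^esub> (c \<odot>\<^bsub>F\<^esub> f)"
    if f: "f \<in> carrier F" and c: "c \<in> carrier R"
  proof -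
    have "K +>\<^bsub>F\<^esub> (c \<odot>\<^bsub>F\<^esub> g) = K +>\<^bsub>F\<^esub> (c \<odot>\<^bsub>F\<^esub> f)" if g: "g \<in> K +>\<^bsub>F\<^esub> f" for g
    proof -
      obtain k where k: "k \<in> K" "g = k \<oplus>\<^bsub>F\<^esub> f" using g by (auto simp: a_r_coset_def')
      have kF: "k \<in> carrier F" using k E(1) by auto
      have ck: "c \<odot>\<^bsub>F\<^esub> k \<in> K" using E(4) c k by auto
      have "c \<odot>\<^bsub>F\<^esub> g \<ominus>\<^bsub>F\<^esub> c \<odot>\<^bsub>F\<^esub> f = c \<odot>\<^bsub>F\<^esub> k"
        using f c kF k(2) by (simp add: F.smult_r_distr a_minus_def F.M.a_assoc F.M.r_neg)
      then show ?thesis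
        using tensor_coset_eqI[OF assms(1,2), of "c \<odot>\<^bsub>F\<^esub> g" "c \<odot>\<^bsub>F\<^esub> f"] f c kF k(2) ck
        unfolding F_def K_def by (simp add: F.M.a_closed[unfolded F_def] F.smult_closed[unfolded F_def])
    qed
    moreover have "K +>\<^bsub>F\<^esub> f \<noteq> {}" using E(2) by (auto simp: a_r_coset_def')
    ultimately show ?thesis by auto
  qed
qed

lemma module_tensor_algebra:
  assumes "module R M" "module R N"
  shows "module R (tensor_algebra R M N)"
proof -
  interpret M: module R M by fact
  let ?F = "tensor_free R M N" and ?K = "tensor_kernel R M N" and ?T = "tensor_algebra R M N"
  interpret F: module R ?F
    by (rule module_free_module) (rule M.R.is_cring)
  note T = tensor_coset[OF assms]
  define cl where "cl f = ?K +>\<^bsub>?F\<^esub> f" for f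
  have cl: "cl f \<in> carrier ?T" if "f \<in> carrier ?F" for f
    unfolding tensor_algebra_sel cl_def T(1) using that by blast
  have ex: "\<exists>f\<in>carrier ?F. t = cl f" if "t \<in> carrier ?T" for t
    using that unfolding tensor_algebra_sel cl_def T(1) .
  have z: "\<zero>\<^bsub>?T\<^esub> = cl \<zero>\<^bsub>?F\<^esub>" unfolding tensor_algebra_sel cl_def T(2) ..
  have ad: "cl f \<oplus>\<^bsub>?T\<^esub> cl g = cl (f \<oplus>\<^bsub>?F\<^esub> g)" if "f \<in> carrier ?F" "g \<in> carrier ?F" for f g
    unfolding tensor_algebra_sel cl_def using that by (rule T(3))
  have sm: "c \<odot>\<^bsub>?T\<^esub> cl f = cl (c \<odot>\<^bsub>?F\<^esub> f)" if "f \<in> carrier ?F" "c \<in> carrier R" for c f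
    unfolding tensor_algebra_sel cl_def using that by (rule T(4))
  have ag: "abelian_group ?T"
  proof (rule abelian_groupI)
    show "\<zero>\<^bsub>?T\<^esub> \<in> carrier ?T" unfolding z by (rule cl) simp
  next
    fix s assume "s \<in> carrier ?T"
    then obtain f where f: "f \<in> carrier ?F" "s = cl f" using ex by blast
    show "\<zero>\<^bsub>?T\<^esub> \<oplus>\<^bsub>?T\<^esub> s = s" unfolding z f(2) using f(1) by (simp add: ad)
    show "\<exists>t\<in>carrier ?T. t \<oplus>\<^bsub>?T\<^esub> s = \<zero>\<^bsub>?T\<^esub>"
      unfolding z f(2) using f(1) by (intro bexI[of _ "cl (\<ominus>\<^bsub>?F\<^esub> f)"]) (simp_all add: ad cl F.M.l_neg)
    fix t assume "t \<in> carrier ?T"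
    then obtain g where g: "g \<in> carrier ?F" "t = cl g" using ex by blast
    show "s \<oplus>\<^bsub>?T\<^esub> t \<in> carrier ?T" "s \<oplus>\<^bsub>?T\<^esub> t = t \<oplus>\<^bsub>?T\<^esub> s"
      unfolding f(2) g(2) using f(1) g(1) by (simp_all add: ad cl F.M.a_comm)
    fix u assume "u \<in> carrier ?T"
    then obtain h where h: "h \<in> carrier ?F" "u = cl h" using ex by blast
    show "s \<oplus>\<^bsub>?T\<^esub> t \<oplus>\<^bsub>?T\<^esub> u = s \<oplus>\<^bsub>?T\<^esub> (t \<oplus>\<^bsub>?T\<^esub> u)"
      unfolding f(2) g(2) h(2) using f(1) g(1) h(1) by (simp add: ad F.M.a_assoc)
  qed
  show ?thesis
  proof (rule moduleI[OF M.R.is_cring ag])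
    fix c s assume c: "c \<in> carrier R" and "s \<in> carrier ?T"
    then obtain f where f: "f \<in> carrier ?F" "s = cl f" using ex by blast
    show "c \<odot>\<^bsub>?T\<^esub> s \<in> carrier ?T" unfolding f(2) using c f(1) by (simp add: sm cl)
    {
      fix d assume d: "d \<in> carrier R"
      show "(c \<oplus>\<^bsub>R\<^esub> d) \<odot>\<^bsub>?T\<^esub> s = c \<odot>\<^bsub>?T\<^esub> s \<oplus>\<^bsub>?T\<^esub> d \<odot>\<^bsub>?T\<^esub> s"
        "(c \<otimes>\<^bsub>R\<^esub> d) \<odot>\<^bsub>?T\<^esub> s = c \<odot>\<^bsub>?T\<^esub> (d \<odot>\<^bsub>?T\<^esub> s)"
        unfolding f(2) using c d f(1) by (simp_all add: ad sm F.smult_l_distr F.smult_assoc1)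
    }
    fix t assume "t \<in> carrier ?T"
    then obtain g where g: "g \<in> carrier ?F" "t = cl g" using ex by blast
    show "c \<odot>\<^bsub>?T\<^esub> (s \<oplus>\<^bsub>?T\<^esub> t) = c \<odot>\<^bsub>?T\<^esub> s \<oplus>\<^bsub>?T\<^esub> c \<odot>\<^bsub>?T\<^esub> t"
      unfolding f(2) g(2) using c f(1) g(1) by (simp add: ad sm F.smult_r_distr)
  next
    fix s assume "s \<in> carrier ?T"
    then obtain f where f: "f \<in> carrier ?F" "s = cl f" using ex by blast
    show "\<one>\<^bsub>R\<^esub> \<odot>\<^bsub>?T\<^esub> s = s" unfolding f(2) using f(1) by (simp add: sm)
  qed
qed

lemma tensor_module_eq:
  "carrier (tensor_module R M N) = carrier (tensor_algebra R M N)"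
  "\<zero>\<^bsub>tensor_module R M N\<^esub> = \<zero>\<^bsub>tensor_algebra R M N\<^esub>"
  "s \<oplus>\<^bsub>tensor_module R M N\<^esub> t = s \<oplus>\<^bsub>tensor_algebra R M N\<^esub> t"
  "c \<odot>\<^bsub>tensor_module R M N\<^esub> t = c \<odot>\<^bsub>tensor_algebra R M N\<^esub> t"
  by (simp_all add: tensor_algebra_def)

lemma module_tensor_module:
  assumes "module R M" "module R N"
  shows "module R (tensor_module R M N)"
proof -
  interpret T: module R "tensor_algebra R M N" by (rule module_tensor_algebra[OF assms])
  show ?thesis
  proof (rule moduleI[OF T.R.is_cring])
    show "abelian_group (tensor_module R M N)"
      by (rule abelian_groupI; unfold tensor_module_eq)
        (auto simp: T.M.a_ac intro: T.M.l_neg T.M.a_inv_closed)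
  qed (unfold tensor_module_eq, auto simp: T.smult_l_distr T.smult_r_distr T.smult_assoc1)
qed

lemma bilinear_tensor_module:
  "bilinear_map R M N (tensor_module R A B) = bilinear_map R M N (tensor_algebra R A B)"
  by (simp add: fun_eq_iff bilinear_map_def linear_map_def tensor_module_eq)

lemma tensor_relationsI:
  fixes R :: "('k, 'r) ring_scheme"
    and M :: "('k, 'm, 's) module_scheme" and N :: "('k, 'n, 't) module_scheme"
  defines "F \<equiv> tensor_free R M N"
  assumes "x \<in> carrier M" "y \<in> carrier N"
  shows "x' \<in> carrier M \<Longrightarrow> free_gen R (x \<oplus>\<^bsub>M\<^esub> x', y)
      \<ominus>\<^bsub>F\<^esub> (free_gen R (x, y) \<oplus>\<^bsub>F\<^esub> free_gen R (x', y)) \<in> tensor_relations R M N"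
    and "y' \<in> carrier N \<Longrightarrow> free_gen R (x, y \<oplus>\<^bsub>N\<^esub> y')
      \<ominus>\<^bsub>F\<^esub> (free_gen R (x, y) \<oplus>\<^bsub>F\<^esub> free_gen R (x, y')) \<in> tensor_relations R M N"
    and "c \<in> carrier R \<Longrightarrow> free_gen R (c \<odot>\<^bsub>M\<^esub> x, y)
      \<ominus>\<^bsub>F\<^esub> c \<odot>\<^bsub>F\<^esub> free_gen R (x, y) \<in> tensor_relations R M N"
    and "c \<in> carrier R \<Longrightarrow> free_gen R (x, c \<odot>\<^bsub>N\<^esub> y)
      \<ominus>\<^bsub>F\<^esub> c \<odot>\<^bsub>F\<^esub> free_gen R (x, y) \<in> tensor_relations R M N"
  using assms(2,3) unfolding tensor_relations_def Let_def F_def by blast+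

lemma bilinear_pure_tensor:
  assumes "module R M" "module R N"
  shows "bilinear_map R M N (tensor_algebra R M N) (pure_tensor R M N)"
proof -
  interpret M: module R M by fact
  interpret N: module R N by fact
  let ?F = "tensor_free R M N" and ?K = "tensor_kernel R M N"
  interpret F: module R ?F
    by (rule module_free_module) (rule M.R.is_cring)
  note T = tensor_coset[OF assms]
  have g: "free_gen R (x, y) \<in> carrier ?F" if "x \<in> carrier M" "y \<in> carrier N" for x y
    by (rule free_gen_carrier[OF M.R.is_cring]) (use that in auto)
  have K: "\<And>f. f \<in> tensor_relations R M N \<Longrightarrow> f \<in> ?K" using tensor_relations_kernel by blast
  note I = tensor_coset_eqI[OF assms _ _ K]
  show ?thesis
    unfolding bilinear_map_def linear_map_def tensor_algebra_sel pure_tensor_def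
  proof (intro conjI ballI funcsetI)
    fix x y assume x: "x \<in> carrier M" and y: "y \<in> carrier N"
    show "?K +>\<^bsub>?F\<^esub> free_gen R (x, y) \<in> a_rcosets\<^bsub>?F\<^esub> ?K"
      "?K +>\<^bsub>?F\<^esub> free_gen R (x, y) \<in> a_rcosets\<^bsub>?F\<^esub> ?K"
      using g[OF x y] by (auto simp: T)
    note rel = tensor_relationsI[OF x y]
    {
      fix y' assume y': "y' \<in> carrier N"
      show "?K +>\<^bsub>?F\<^esub> free_gen R (x, y \<oplus>\<^bsub>N\<^esub> y') =
          (?K +>\<^bsub>?F\<^esub> free_gen R (x, y)) <+>\<^bsub>?F\<^esub> (?K +>\<^bsub>?F\<^esub> free_gen R (x, y'))"
        unfolding T(3)[OF g[OF x y] g[OF x y']]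
        by (rule I[OF g F.M.a_closed[OF g g] rel(2)]) (use x y y' in simp_all)
    }
    {
      fix x' assume x': "x' \<in> carrier M"
      show "?K +>\<^bsub>?F\<^esub> free_gen R (x \<oplus>\<^bsub>M\<^esub> x', y) =
          (?K +>\<^bsub>?F\<^esub> free_gen R (x, y)) <+>\<^bsub>?F\<^esub> (?K +>\<^bsub>?F\<^esub> free_gen R (x', y))"
        unfolding T(3)[OF g[OF x y] g[OF x' y]]
        by (rule I[OF g F.M.a_closed[OF g g] rel(1)]) (use x y x' in simp_all)
    }
    fix c assume c: "c \<in> carrier R"
    show "?K +>\<^bsub>?F\<^esub> free_gen R (x, c \<odot>\<^bsub>N\<^esub> y) =
        (\<Union>f\<in>?K +>\<^bsub>?F\<^esub> free_gen R (x, y). ?K +>\<^bsub>?F\<^esub> (c \<odot>\<^bsub>?F\<^esub> f))"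
      unfolding T(4)[OF g[OF x y] c]
      by (rule I[OF g F.smult_closed[OF c g] rel(4)]) (use x y c in simp_all)
    show "?K +>\<^bsub>?F\<^esub> free_gen R (c \<odot>\<^bsub>M\<^esub> x, y) =
        (\<Union>f\<in>?K +>\<^bsub>?F\<^esub> free_gen R (x, y). ?K +>\<^bsub>?F\<^esub> (c \<odot>\<^bsub>?F\<^esub> f))"
      unfolding T(4)[OF g[OF x y] c]
      by (rule I[OF g F.smult_closed[OF c g] rel(3)]) (use x y c in simp_all)
  qed
qed

lemma linear_tensor_lift:
  assumes "module R M" "module R N" "module R P" "bilinear_map R M N P B"
  shows "linear_map R (tensor_algebra R M N) P (tensor_lift R P B)"
proof -
  interpret M: module R M by fact
  let ?F = "tensor_free R M N" and ?K = "tensor_kernel R M N" and ?T = "tensor_algebra R M N"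
  interpret F: module R ?F
    by (rule module_free_module) (rule M.R.is_cring)
  note T = tensor_coset[OF assms(1,2)] and L = tensor_lift_coset[OF assms]
  note E = linear_mapD[OF linear_map_tensor_eval[OF assms(3) bilinear_map_funcset[OF assms(4)]]]
  show ?thesis
    unfolding linear_map_def
  proof (intro conjI ballI funcsetI)
    fix s assume "s \<in> carrier ?T"
    then obtain f where f: "f \<in> carrier ?F" "s = ?K +>\<^bsub>?F\<^esub> f"
      unfolding tensor_algebra_sel T(1) by blast
    show "tensor_lift R P B s \<in> carrier P" unfolding f(2) using f(1) by (simp add: L E)
    show "tensor_lift R P B (c \<odot>\<^bsub>?T\<^esub> s) = c \<odot>\<^bsub>P\<^esub> tensor_lift R P B s" if "c \<in> carrier R" for c
      unfolding f(2) tensor_algebra_sel T(4)[OF f(1) that] using f(1) that by (simp add: L E)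
    fix t assume "t \<in> carrier ?T"
    then obtain g where g: "g \<in> carrier ?F" "t = ?K +>\<^bsub>?F\<^esub> g"
      unfolding tensor_algebra_sel T(1) by blast
    show "tensor_lift R P B (s \<oplus>\<^bsub>?T\<^esub> t) = tensor_lift R P B s \<oplus>\<^bsub>P\<^esub> tensor_lift R P B t"
      unfolding f(2) g(2) tensor_algebra_sel T(3)[OF f(1) g(1)] using f(1) g(1) by (simp add: L E)
  qed
qed

lemma tensor_mult_pure:
  assumes "assoc_algebra R A" "assoc_algebra R B"
    and "a \<in> carrier A" "b \<in> carrier B" "a' \<in> carrier A" "b' \<in> carrier B"
  shows "pure_tensor R A B a b \<otimes>\<^bsub>tensor_algebra R A B\<^esub> pure_tensor R A B a' b' =
    pure_tensor R A B (a \<otimes>\<^bsub>A\<^esub> a') (b \<otimes>\<^bsub>B\<^esub> b')"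
proof -
  interpret A: assoc_algebra R A by fact
  interpret B: assoc_algebra R B by fact
  let ?T = "tensor_module R A B"
  note mods = A.module_axioms B.module_axioms module_tensor_module[OF A.module_axioms B.module_axioms]
  note p = bilinear_mapD[OF bilinear_pure_tensor[OF mods(1,2)]]
  note alg = A.smult_mult_left A.smult_mult_right B.smult_mult_left B.smult_mult_right
    A.A.l_distr A.A.r_distr B.A.l_distr B.A.r_distr
  have bil: "bilinear_map R A B ?T (\<lambda>x y. pure_tensor R A B (a \<otimes>\<^bsub>A\<^esub> x) (b \<otimes>\<^bsub>B\<^esub> y))"
    if "a \<in> carrier A" "b \<in> carrier B" for a b
    unfolding bilinear_tensor_module
    unfolding bilinear_map_def linear_map_def
    using that by (auto simp: alg p)
  have bil': "bilinear_map R A B ?T (\<lambda>x y. tensor_lift R ?T (\<lambda>a' b'.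
        pure_tensor R A B (x \<otimes>\<^bsub>A\<^esub> a') (y \<otimes>\<^bsub>B\<^esub> b')) (pure_tensor R A B a' b'))"
    unfolding bilinear_tensor_module
    unfolding bilinear_map_def linear_map_def
    using assms(5,6) by (auto simp: alg p tensor_lift_pure[OF mods bil])
  show ?thesis
    using assms(3-6) by (simp add: tensor_algebra_sel tensor_lift_pure[OF mods bil'] tensor_lift_pure[OF mods bil])
qed

end

theory Submission
  imports Defs
begin

text \<open>Everything turns on the image of the unit. If \<open>\<rho> 1 = 1 \<otimes> 1\<close>,
  the factors \<open>1_[0]\<close> and \<open>1_[1]\<close> in the partial coassociativity law are
  units, so that law collapses to the ordinary one
  (\<open>coaction_partial_comult_eq_coaction_comult\<close>); moreover
  \<open>\<epsilon>(1_[1]) 1_[0] = 1\<close>, so the weak axioms are the ordinary ones. Conversely,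
  the partial counit law at \<open>1\<close> gives \<open>\<epsilon>(1_[1]) 1_[0] = 1\<close>, which
  turns the weak unit law into \<open>\<rho> 1 = 1 \<otimes> 1\<close>; the weak axioms supply
  coassociativity.\<close>

text \<open>The representative chosen in \<open>tensor_lift\<close> depends on \<open>t\<close>
  alone, so both sides are sums over the same support and can be compared term by term. This allows
  rewriting under Sweedler sums by equations valid only on the carriers.\<close>

lemma tensor_lift_cong:
  assumes "module R M" "module R N" "module R P"
    and "t \<in> carrier (tensor_algebra R M N)"
    and "C \<in> carrier M \<rightarrow> carrier N \<rightarrow> carrier P"
    and "\<And>x y. x \<in> carrier M \<Longrightarrow> y \<in> carrier N \<Longrightarrow> B x y = C x y"
  shows "tensor_lift R P B t = tensor_lift R P C t"
proof -
  interpret M: module R M by fact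
  interpret P: module R P by fact
  let ?F = "tensor_free R M N" and ?K = "tensor_kernel R M N"
  interpret F: module R ?F
    by (rule module_free_module) (rule M.R.is_cring)
  note K = F.submoduleE[OF submodule_tensor_kernel[OF assms(1,2)]]
  obtain f where f: "f \<in> carrier ?F" "t = ?K +>\<^bsub>?F\<^esub> f"
    using assms(4) unfolding tensor_algebra_sel tensor_coset[OF assms(1,2)] by blast
  \<comment> \<open>The kernel contains zero, so the coset is nonempty and the chosen representative
    really lies in it.\<close>
  have "t \<noteq> {}" using K(2) f(2) by (auto simp: a_r_coset_def')
  then have "(SOME g. g \<in> t) \<in> t" by (simp add: some_in_eq)
  moreover have "t \<subseteq> carrier ?F"
    unfolding f(2) using K(1) f(1) by (auto simp: a_r_coset_def')
  ultimately have g: "(SOME g. g \<in> t) \<in> carrier ?F" by blast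
  then have sub: "{p. (SOME g. g \<in> t) p \<noteq> \<zero>\<^bsub>R\<^esub>} \<subseteq> carrier M \<times> carrier N"
    and coeff: "(SOME g. g \<in> t) p \<in> carrier R" for p
    by (auto simp: free_module_simps)
  show ?thesis
    unfolding tensor_lift_def tensor_eval_def
  proof (rule P.M.finsum_cong')
    fix p assume "p \<in> {p. (SOME g. g \<in> t) p \<noteq> \<zero>\<^bsub>R\<^esub>}"
    then have "fst p \<in> carrier M" "snd p \<in> carrier N" using sub by auto
    then show "(SOME g. g \<in> t) p \<odot>\<^bsub>P\<^esub> B (fst p) (snd p) = (SOME g. g \<in> t) p \<odot>\<^bsub>P\<^esub> C (fst p) (snd p)"
      by (simp add: assms(6))
  next
    show "(\<lambda>p. (SOME g. g \<in> t) p \<odot>\<^bsub>P\<^esub> C (fst p) (snd p))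
      \<in> {p. (SOME g. g \<in> t) p \<noteq> \<zero>\<^bsub>R\<^esub>} \<rightarrow> carrier P"
      using sub assms(5) coeff by (fastforce simp: Pi_iff)
  qed simp
qed

text \<open>The innermost sum runs over \<open>\<rho> 1\<close>, here a pure tensor of units, so it
  reduces to a single term in which multiplying by the units changes nothing.\<close>

lemma coaction_partial_comult_eq_coaction_comult:
  assumes "assoc_algebra R A" "assoc_algebra R H"
    and \<delta>: "linear_map R H (tensor_algebra R H H) \<delta>"
    and \<rho>: "linear_map R A (tensor_algebra R A H) \<rho>"
    and one: "\<rho> \<one>\<^bsub>A\<^esub> = pure_tensor R A H \<one>\<^bsub>A\<^esub> \<one>\<^bsub>H\<^esub>"
    and a: "a \<in> carrier A"
  shows "coaction_partial_comult R A H \<delta> \<rho> a = coaction_comult R A H \<delta> \<rho> a"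
proof -
  interpret A: assoc_algebra R A by fact
  interpret H: assoc_algebra R H by fact
  note AH = A.module_axioms H.module_axioms
  note T = module_tensor_algebra[OF AH]
  note P = module_tensor_algebra[OF T H.module_axioms]
  note p2 = bilinear_mapD[OF bilinear_pure_tensor[OF AH]]
  note p3 = bilinear_mapD[OF bilinear_pure_tensor[OF T H.module_axioms]]
  let ?P = "tensor_algebra3 R A H H"
  \<comment> \<open>Bilinearity in \<open>e0\<close> and \<open>e1\<close> is what permits
    evaluating the lift at a pure tensor.\<close>
  have bil_mult: "bilinear_map R A H ?P
      (\<lambda>e0 e1. pure_tensor3 R A H H (x \<otimes>\<^bsub>A\<^esub> e0) (y \<otimes>\<^bsub>H\<^esub> e1) z)"
    if "x \<in> carrier A" "y \<in> carrier H" "z \<in> carrier H" for x y z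
    unfolding bilinear_map_def linear_map_def
    using that by (auto simp: p2 p3 A.smult_mult_right H.smult_mult_right A.A.r_distr H.A.r_distr)
  have bil: "bilinear_map R H H ?P (\<lambda>y z. pure_tensor3 R A H H x y z)"
    if "x \<in> carrier A" for x
    unfolding bilinear_map_def linear_map_def
    using that by (auto simp: p2 p3)
  have unit: "tensor_lift R ?P
      (\<lambda>e0 e1. pure_tensor3 R A H H (x \<otimes>\<^bsub>A\<^esub> e0) (y \<otimes>\<^bsub>H\<^esub> e1) z) (\<rho> \<one>\<^bsub>A\<^esub>) = pure_tensor3 R A H H x y z"
    if "x \<in> carrier A" "y \<in> carrier H" "z \<in> carrier H" for x y z
    unfolding one using that by (simp add: tensor_lift_pure[OF AH P bil_mult])
  \<comment> \<open>The collapse is carried outwards one Sweedler sum at a time: here through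
    \<open>\<delta> h\<close>, afterwards through \<open>\<rho> a\<close>.\<close>
  have inner: "tensor_lift R ?P (\<lambda>y z. tensor_lift R ?P
        (\<lambda>e0 e1. pure_tensor3 R A H H (x \<otimes>\<^bsub>A\<^esub> e0) (y \<otimes>\<^bsub>H\<^esub> e1) z) (\<rho> \<one>\<^bsub>A\<^esub>)) (\<delta> h) =
      tensor_lift R ?P (\<lambda>y z. pure_tensor3 R A H H x y z) (\<delta> h)"
    if "x \<in> carrier A" "h \<in> carrier H" for x h
    by (rule tensor_lift_cong[OF H.module_axioms H.module_axioms P linear_mapD(1)[OF \<delta>]
          bilinear_map_funcset[OF bil] unit]) (use that in auto)
  show ?thesis
    unfolding coaction_partial_comult_def coaction_comult_def
  proof (rule tensor_lift_cong[OF AH P linear_mapD(1)[OF \<rho> a] _ inner])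
    show "(\<lambda>x h. tensor_lift R ?P (\<lambda>y z. pure_tensor3 R A H H x y z) (\<delta> h))
        \<in> carrier A \<rightarrow> carrier H \<rightarrow> carrier ?P"
      \<comment> \<open>The lift of a bilinear map is linear, hence maps \<open>\<delta> h\<close>
        into the threefold tensor product.\<close>
      using linear_mapD(1)[OF linear_tensor_lift[OF H.module_axioms H.module_axioms P bil]]
        linear_mapD(1)[OF \<delta>] by blast
  qed
qed

theorem proposition2p7:
  fixes R :: "('k, 'r) ring_scheme"
    and A :: "('k, 'a, 's) module_scheme"
    and H :: "('k, 'h, 't) module_scheme"
    and \<delta> :: "'h \<Rightarrow> ('h \<times> 'h \<Rightarrow> 'k) set"
    and \<epsilon> :: "'h \<Rightarrow> 'k"
    and \<rho> :: "'a \<Rightarrow> ('a \<times> 'h \<Rightarrow> 'k) set"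
  assumes "cring R"
    and "assoc_algebra R A"
    and "bialgebra R H \<delta> \<epsilon>"
    and "linear_map R A (tensor_algebra R A H) \<rho>"
  shows "right_comodule_algebra R A H \<delta> \<epsilon> \<rho> \<longleftrightarrow>
         right_partial_comodule_algebra R A H \<delta> \<epsilon> \<rho> \<and>
         right_weak_comodule_algebra R A H \<delta> \<epsilon> \<rho>"
proof -
  interpret A: assoc_algebra R A by fact
  interpret H: bialgebra R H \<delta> \<epsilon> by fact
  note partial = coaction_partial_comult_eq_coaction_comult[OF assms(2) H.assoc_algebra_axioms
      H.comult_linear assms(4)]
  show ?thesis
  proof (intro iffI conjI)
    assume comod: "right_comodule_algebra R A H \<delta> \<epsilon> \<rho>"
    then have one: "\<rho> \<one>\<^bsub>A\<^esub> = pure_tensor R A H \<one>\<^bsub>A\<^esub> \<one>\<^bsub>H\<^esub>"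
      and counit: "\<And>a. a \<in> carrier A \<Longrightarrow> coaction_counit R A \<epsilon> \<rho> a = a"
      by (simp_all add: right_comodule_algebra_def)
    show "right_partial_comodule_algebra R A H \<delta> \<epsilon> \<rho>"
      using comod by (simp add: right_comodule_algebra_def right_partial_comodule_algebra_def partial[OF one])
    show "right_weak_comodule_algebra R A H \<delta> \<epsilon> \<rho>"
      \<comment> \<open>Rewriting only the counit at \<open>1\<close> leaves the weak counit law as
        \<open>\<epsilon>(a_[1]) a_[0] = 1 a\<close>.\<close>
      unfolding right_weak_comodule_algebra_def counit[OF A.A.one_closed]
      using comod by (simp add: right_comodule_algebra_def)
  next
    assume pw: "right_partial_comodule_algebra R A H \<delta> \<epsilon> \<rho> \<and>
      right_weak_comodule_algebra R A H \<delta> \<epsilon> \<rho>"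
    then have counit: "\<And>a. a \<in> carrier A \<Longrightarrow> coaction_counit R A \<epsilon> \<rho> a = a"
      by (simp add: right_partial_comodule_algebra_def)
    have weak: "right_weak_comodule_algebra R A H \<delta> \<epsilon> \<rho>" using pw ..
    show "right_comodule_algebra R A H \<delta> \<epsilon> \<rho>"
      using weak counit
      \<comment> \<open>The partial counit law, applied at \<open>1\<close>, turns the weak unit law
        into \<open>\<rho> 1 = 1 \<otimes> 1\<close>.\<close>
      unfolding right_weak_comodule_algebra_def counit[OF A.A.one_closed] right_comodule_algebra_def
      by blast
  qed
qed

end
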